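(* (Variant of the Master Theorem.) Let $\varphi$ be an LTL formula in negation normal form and let $w$ be an infinite word over $2^{Ap}$. Then $w \models \varphi$ if and only if there exist $X \subseteq \mu(\varphi)$, $Y \subseteq \nu(\varphi)$ and $i \geq 0$ satisfying: (1') $w_i \models (\mathit{af}(\varphi, w_{0i}))[X]_\nu$; (2') for every $\psi \in X$: $w_i \models \mathbf{G}\mathbf{F}(\psi[Y]_\mu)$; (3') for every $\psi \in Y$: $w_i \models \mathbf{G}(\psi[X]_\nu)$.
   Context: LTL formulas in negation normal form over a finite set $Ap$ of atomic propositions are given by $\varphi ::= \mathbf{tt} \mid \mathbf{ff} \mid a \mid \neg a \mid \varphi\wedge\varphi \mid \varphi\vee\varphi \mid \mathbf{X}\varphi \mid \mathbf{F}\varphi \mid \mathbf{G}\varphi \mid \varphi\mathbf{U}\varphi \mid \varphi\mathbf{W}\varphi \mid \varphi\mathbf{M}\varphi \mid \varphi\mathbf{R}\varphi$ with $a \in Ap$. For an infinite word $w$ over $2^{Ap}$, $w_i$ is the suffix $w[i]w[i+1]\cdots$ and $w_{ij}$ the finite infix $w[i]\cdots w[j-1]$. Semantics: standard for $\mathbf{tt},\mathbf{ff},a,\neg a,\wedge,\vee,\mathbf{X},\mathbf{F},\mathbf{G},\mathbf{U}$; $w\models\varphi\mathbf{W}\psi$ iff $w\models\mathbf{G}\varphi$ or $w\models\varphi\mathbf{U}\psi$; $w\models\varphi\mathbf{M}\psi$ iff $\exists k.\,w_k\models\varphi$ and $\forall j\le k.\,w_j\models\psi$; $w\models\varphi\mathbf{R}\psi$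 iff $w\models\mathbf{G}\psi$ or $w\models\varphi\mathbf{M}\psi$. The function $\mathit{af}$: for a letter $\nu\in 2^{Ap}$, $\mathit{af}(a,\nu)=\mathbf{tt}$ if $a\in\nu$ and $\mathbf{ff}$ otherwise; $\mathit{af}(\neg a,\nu)=\mathbf{ff}$ if $a\in\nu$ and $\mathbf{tt}$ otherwise; $\mathit{af}(\mathbf{tt},\nu)=\mathbf{tt}$, $\mathit{af}(\mathbf{ff},\nu)=\mathbf{ff}$; $\mathit{af}$ commutes with $\wedge,\vee$; $\mathit{af}(\mathbf{X}\varphi,\nu)=\varphi$; $\mathit{af}(\mathbf{F}\varphi,\nu)=\mathit{af}(\varphi,\nu)\vee\mathbf{F}\varphi$; $\mathit{af}(\mathbf{G}\varphi,\nu)=\mathit{af}(\varphi,\nu)\wedge\mathbf{G}\varphi$; $\mathit{af}(\varphi\mathbf{U}\psi,\nu)=\mathit{af}(\psi,\nu)\vee(\mathit{af}(\varphi,\nu)\wedge\varphi\mathbf{U}\psi)$; same shape for $\mathbf{W}$; $\mathit{af}(\varphi\mathbf{M}\psi,\nu)=\mathit{af}(\psi,\nu)\wedge(\mathit{af}(\varphi,\nu)\vee\varphi\mathbf{M}\psi)$; same shape for $\mathbf{R}$. Extended to finite words by $\mathit{af}(\varphi,\epsilon)=\varphi$, $\mathit{af}(\varphi,\nu u)=\mathit{af}(\mathit{af}(\varphi,\nu),u)$. $\mu(\varphi)$ is the set of subformulas of $\varphi$ of the form $\mathbf{F}\psi$, $\psi_1\mathbf{U}\psi_2$, $\psi_1\mathbf{M}\psi_2$;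 $\nu(\varphi)$ the set of subformulas of the form $\mathbf{G}\psi$, $\psi_1\mathbf{W}\psi_2$, $\psi_1\mathbf{R}\psi_2$. For a set $X$ of formulas, $\psi[X]_\nu$: it is $\psi$ for $\psi\in\{\mathbf{tt},\mathbf{ff},a,\neg a\}$; it commutes with $\mathbf{X},\mathbf{G},\wedge,\vee,\mathbf{W},\mathbf{R}$; $(\mathbf{F}\psi)[X]_\nu=\mathbf{tt}$ if $\mathbf{F}\psi\in X$, else $\mathbf{ff}$; $(\psi_1\mathbf{U}\psi_2)[X]_\nu=(\psi_1[X]_\nu)\mathbf{W}(\psi_2[X]_\nu)$ if $\psi_1\mathbf{U}\psi_2\in X$, else $\mathbf{ff}$; $(\psi_1\mathbf{M}\psi_2)[X]_\nu=(\psi_1[X]_\nu)\mathbf{R}(\psi_2[X]_\nu)$ if $\psi_1\mathbf{M}\psi_2\in X$, else $\mathbf{ff}$. For a set $Y$ of formulas, $\psi[Y]_\mu$: it is $\psi$ for $\psi\in\{\mathbf{tt},\mathbf{ff},a,\neg a\}$; it commutes with $\mathbf{X},\mathbf{F},\wedge,\vee,\mathbf{U},\mathbf{M}$; $(\mathbf{G}\psi)[Y]_\mu=\mathbf{tt}$ if $\mathbf{G}\psi\in Y$, else $\mathbf{ff}$; $(\psi_1\mathbf{W}\psi_2)[Y]_\mu=\mathbf{tt}$ if $\psi_1\mathbf{W}\psi_2\in Y$, else $(\psi_1[Y]_\mu)\mathbf{U}(\psi_2[Y]_\mu)$; $(\psi_1\mathbf{R}\psi_2)[Y]_\mu=\mathbf{tt}$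 if $\psi_1\mathbf{R}\psi_2\in Y$, else $(\psi_1[Y]_\mu)\mathbf{M}(\psi_2[Y]_\mu)$. *)

theory Defs
  imports "HOL-Library.Omega_Words_Fun"
begin

text \<open>
  Infinite words, their suffixes \<open>suffix i w\<close> and their finite infixes \<open>w[i \<rightarrow> j]\<close>
  (letters \<open>i\<close> up to \<open>j - 1\<close>, as a list) are those of \<^theory>\<open>HOL-Library.Omega_Words_Fun\<close>.
\<close>

datatype (atoms: 'a) ltl =
    TT
  | FF
  | Prop 'a
  | NProp 'a
  | And "'a ltl" "'a ltl"  (infixr \<open>\<^bold>\<and>\<close> 74)
  | Or "'a ltl" "'a ltl"  (infixr \<open>\<^bold>\<or>\<close> 73)
  | Next "'a ltl"  (\<open>\<X> _\<close> [80] 80)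
  | Finally "'a ltl"  (\<open>\<F> _\<close> [80] 80)
  | Globally "'a ltl"  (\<open>\<G> _\<close> [80] 80)
  | Until "'a ltl" "'a ltl"  (infixr \<open>\<U>\<close> 76)
  | WeakUntil "'a ltl" "'a ltl"  (infixr \<open>\<W>\<close> 76)
  | StrongRelease "'a ltl" "'a ltl"  (infixr \<open>\<M>\<close> 76)
  | Release "'a ltl" "'a ltl"  (infixr \<open>\<R>\<close> 76)

text \<open>
  The defining clauses of weak until and release are unfolded to make the recursion structural;
  their usual form is recovered in the two lemmas that follow.
\<close>

primrec models :: "'a set word \<Rightarrow> 'a ltl \<Rightarrow> bool"  (infix \<open>\<Turnstile>\<close> 60) where
  "w \<Turnstile> TT \<longleftrightarrow> True"
| "w \<Turnstile> FF \<longleftrightarrow> False"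
| "w \<Turnstile> Prop a \<longleftrightarrow> a \<in> w 0"
| "w \<Turnstile> NProp a \<longleftrightarrow> a \<notin> w 0"
| "w \<Turnstile> \<phi> \<^bold>\<and> \<psi> \<longleftrightarrow> w \<Turnstile> \<phi> \<and> w \<Turnstile> \<psi>"
| "w \<Turnstile> \<phi> \<^bold>\<or> \<psi> \<longleftrightarrow> w \<Turnstile> \<phi> \<or> w \<Turnstile> \<psi>"
| "w \<Turnstile> \<X> \<phi> \<longleftrightarrow> suffix 1 w \<Turnstile> \<phi>"
| "w \<Turnstile> \<F> \<phi> \<longleftrightarrow> (\<exists>k. suffix k w \<Turnstile> \<phi>)"
| "w \<Turnstile> \<G> \<phi> \<longleftrightarrow> (\<forall>k. suffix k w \<Turnstile> \<phi>)"
| "w \<Turnstile> \<phi> \<U> \<psi> \<longleftrightarrow> (\<exists>k. suffix k w \<Turnstile> \<psi> \<and> (\<forall>j<k. suffix j w \<Turnstile> \<phi>))"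
| "w \<Turnstile> \<phi> \<W> \<psi> \<longleftrightarrow>
    (\<forall>k. suffix k w \<Turnstile> \<phi>) \<or> (\<exists>k. suffix k w \<Turnstile> \<psi> \<and> (\<forall>j<k. suffix j w \<Turnstile> \<phi>))"
| "w \<Turnstile> \<phi> \<M> \<psi> \<longleftrightarrow> (\<exists>k. suffix k w \<Turnstile> \<phi> \<and> (\<forall>j\<le>k. suffix j w \<Turnstile> \<psi>))"
| "w \<Turnstile> \<phi> \<R> \<psi> \<longleftrightarrow>
    (\<forall>k. suffix k w \<Turnstile> \<psi>) \<or> (\<exists>k. suffix k w \<Turnstile> \<phi> \<and> (\<forall>j\<le>k. suffix j w \<Turnstile> \<psi>))"

lemma models_WeakUntil: "w \<Turnstile> \<phi> \<W> \<psi> \<longleftrightarrow> w \<Turnstile> \<G> \<phi> \<or> w \<Turnstile> \<phi> \<U> \<psi>"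
  by simp

lemma models_Release: "w \<Turnstile> \<phi> \<R> \<psi> \<longleftrightarrow> w \<Turnstile> \<G> \<psi> \<or> w \<Turnstile> \<phi> \<M> \<psi>"
  by simp

primrec af_letter :: "'a ltl \<Rightarrow> 'a set \<Rightarrow> 'a ltl" where
  "af_letter TT \<sigma> = TT"
| "af_letter FF \<sigma> = FF"
| "af_letter (Prop a) \<sigma> = (if a \<in> \<sigma> then TT else FF)"
| "af_letter (NProp a) \<sigma> = (if a \<in> \<sigma> then FF else TT)"
| "af_letter (\<phi> \<^bold>\<and> \<psi>) \<sigma> = af_letter \<phi> \<sigma> \<^bold>\<and> af_letter \<psi> \<sigma>"
| "af_letter (\<phi> \<^bold>\<or> \<psi>) \<sigma> = af_letter \<phi> \<sigma> \<^bold>\<or> af_letter \<psi> \<sigma>"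
| "af_letter (\<X> \<phi>) \<sigma> = \<phi>"
| "af_letter (\<F> \<phi>) \<sigma> = af_letter \<phi> \<sigma> \<^bold>\<or> \<F> \<phi>"
| "af_letter (\<G> \<phi>) \<sigma> = af_letter \<phi> \<sigma> \<^bold>\<and> \<G> \<phi>"
| "af_letter (\<phi> \<U> \<psi>) \<sigma> = af_letter \<psi> \<sigma> \<^bold>\<or> (af_letter \<phi> \<sigma> \<^bold>\<and> (\<phi> \<U> \<psi>))"
| "af_letter (\<phi> \<W> \<psi>) \<sigma> = af_letter \<psi> \<sigma> \<^bold>\<or> (af_letter \<phi> \<sigma> \<^bold>\<and> (\<phi> \<W> \<psi>))"
| "af_letter (\<phi> \<M> \<psi>) \<sigma> = af_letter \<psi> \<sigma> \<^bold>\<and> (af_letter \<phi> \<sigma> \<^bold>\<or> (\<phi> \<M> \<psi>))"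
| "af_letter (\<phi> \<R> \<psi>) \<sigma> = af_letter \<psi> \<sigma> \<^bold>\<and> (af_letter \<phi> \<sigma> \<^bold>\<or> (\<phi> \<R> \<psi>))"

fun af :: "'a ltl \<Rightarrow> 'a set list \<Rightarrow> 'a ltl" where
  "af \<phi> [] = \<phi>"
| "af \<phi> (\<sigma> # u) = af (af_letter \<phi> \<sigma>) u"

primrec subformulas :: "'a ltl \<Rightarrow> 'a ltl set" where
  "subformulas TT = {TT}"
| "subformulas FF = {FF}"
| "subformulas (Prop a) = {Prop a}"
| "subformulas (NProp a) = {NProp a}"
| "subformulas (\<phi> \<^bold>\<and> \<psi>) = {\<phi> \<^bold>\<and> \<psi>} \<union> subformulas \<phi> \<union> subformulas \<psi>"
| "subformulas (\<phi> \<^bold>\<or> \<psi>) = {\<phi> \<^bold>\<or> \<psi>} \<union> subformulas \<phi> \<union> subformulas \<psi>"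
| "subformulas (\<X> \<phi>) = {\<X> \<phi>} \<union> subformulas \<phi>"
| "subformulas (\<F> \<phi>) = {\<F> \<phi>} \<union> subformulas \<phi>"
| "subformulas (\<G> \<phi>) = {\<G> \<phi>} \<union> subformulas \<phi>"
| "subformulas (\<phi> \<U> \<psi>) = {\<phi> \<U> \<psi>} \<union> subformulas \<phi> \<union> subformulas \<psi>"
| "subformulas (\<phi> \<W> \<psi>) = {\<phi> \<W> \<psi>} \<union> subformulas \<phi> \<union> subformulas \<psi>"
| "subformulas (\<phi> \<M> \<psi>) = {\<phi> \<M> \<psi>} \<union> subformulas \<phi> \<union> subformulas \<psi>"
| "subformulas (\<phi> \<R> \<psi>) = {\<phi> \<R> \<psi>} \<union> subformulas \<phi> \<union> subformulas \<psi>"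

definition mu_subformulas :: "'a ltl \<Rightarrow> 'a ltl set" where
  "mu_subformulas \<phi> =
    {\<chi> \<in> subformulas \<phi>. (\<exists>\<psi>. \<chi> = \<F> \<psi>) \<or> (\<exists>\<psi>\<^sub>1 \<psi>\<^sub>2. \<chi> = \<psi>\<^sub>1 \<U> \<psi>\<^sub>2) \<or> (\<exists>\<psi>\<^sub>1 \<psi>\<^sub>2. \<chi> = \<psi>\<^sub>1 \<M> \<psi>\<^sub>2)}"

definition nu_subformulas :: "'a ltl \<Rightarrow> 'a ltl set" where
  "nu_subformulas \<phi> =
    {\<chi> \<in> subformulas \<phi>. (\<exists>\<psi>. \<chi> = \<G> \<psi>) \<or> (\<exists>\<psi>\<^sub>1 \<psi>\<^sub>2. \<chi> = \<psi>\<^sub>1 \<W> \<psi>\<^sub>2) \<or> (\<exists>\<psi>\<^sub>1 \<psi>\<^sub>2. \<chi> = \<psi>\<^sub>1 \<R> \<psi>\<^sub>2)}"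

primrec subst_nu :: "'a ltl \<Rightarrow> 'a ltl set \<Rightarrow> 'a ltl"  (\<open>_[_]\<^sub>\<nu>\<close> [90, 60] 89) where
  "TT[X]\<^sub>\<nu> = TT"
| "FF[X]\<^sub>\<nu> = FF"
| "(Prop a)[X]\<^sub>\<nu> = Prop a"
| "(NProp a)[X]\<^sub>\<nu> = NProp a"
| "(\<phi> \<^bold>\<and> \<psi>)[X]\<^sub>\<nu> = \<phi>[X]\<^sub>\<nu> \<^bold>\<and> \<psi>[X]\<^sub>\<nu>"
| "(\<phi> \<^bold>\<or> \<psi>)[X]\<^sub>\<nu> = \<phi>[X]\<^sub>\<nu> \<^bold>\<or> \<psi>[X]\<^sub>\<nu>"
| "(\<X> \<phi>)[X]\<^sub>\<nu> = \<X> (\<phi>[X]\<^sub>\<nu>)"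
| "(\<F> \<phi>)[X]\<^sub>\<nu> = (if \<F> \<phi> \<in> X then TT else FF)"
| "(\<G> \<phi>)[X]\<^sub>\<nu> = \<G> (\<phi>[X]\<^sub>\<nu>)"
| "(\<phi> \<U> \<psi>)[X]\<^sub>\<nu> = (if \<phi> \<U> \<psi> \<in> X then (\<phi>[X]\<^sub>\<nu>) \<W> (\<psi>[X]\<^sub>\<nu>) else FF)"
| "(\<phi> \<W> \<psi>)[X]\<^sub>\<nu> = (\<phi>[X]\<^sub>\<nu>) \<W> (\<psi>[X]\<^sub>\<nu>)"
| "(\<phi> \<M> \<psi>)[X]\<^sub>\<nu> = (if \<phi> \<M> \<psi> \<in> X then (\<phi>[X]\<^sub>\<nu>) \<R> (\<psi>[X]\<^sub>\<nu>) else FF)"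
| "(\<phi> \<R> \<psi>)[X]\<^sub>\<nu> = (\<phi>[X]\<^sub>\<nu>) \<R> (\<psi>[X]\<^sub>\<nu>)"

primrec subst_mu :: "'a ltl \<Rightarrow> 'a ltl set \<Rightarrow> 'a ltl"  (\<open>_[_]\<^sub>\<mu>\<close> [90, 60] 89) where
  "TT[Y]\<^sub>\<mu> = TT"
| "FF[Y]\<^sub>\<mu> = FF"
| "(Prop a)[Y]\<^sub>\<mu> = Prop a"
| "(NProp a)[Y]\<^sub>\<mu> = NProp a"
| "(\<phi> \<^bold>\<and> \<psi>)[Y]\<^sub>\<mu> = \<phi>[Y]\<^sub>\<mu> \<^bold>\<and> \<psi>[Y]\<^sub>\<mu>"
| "(\<phi> \<^bold>\<or> \<psi>)[Y]\<^sub>\<mu> = \<phi>[Y]\<^sub>\<mu> \<^bold>\<or> \<psi>[Y]\<^sub>\<mu>"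
| "(\<X> \<phi>)[Y]\<^sub>\<mu> = \<X> (\<phi>[Y]\<^sub>\<mu>)"
| "(\<F> \<phi>)[Y]\<^sub>\<mu> = \<F> (\<phi>[Y]\<^sub>\<mu>)"
| "(\<G> \<phi>)[Y]\<^sub>\<mu> = (if \<G> \<phi> \<in> Y then TT else FF)"
| "(\<phi> \<U> \<psi>)[Y]\<^sub>\<mu> = (\<phi>[Y]\<^sub>\<mu>) \<U> (\<psi>[Y]\<^sub>\<mu>)"
| "(\<phi> \<W> \<psi>)[Y]\<^sub>\<mu> = (if \<phi> \<W> \<psi> \<in> Y then TT else (\<phi>[Y]\<^sub>\<mu>) \<U> (\<psi>[Y]\<^sub>\<mu>))"
| "(\<phi> \<M> \<psi>)[Y]\<^sub>\<mu> = (\<phi>[Y]\<^sub>\<mu>) \<M> (\<psi>[Y]\<^sub>\<mu>)"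
| "(\<phi> \<R> \<psi>)[Y]\<^sub>\<mu> = (if \<phi> \<R> \<psi> \<in> Y then TT else (\<phi>[Y]\<^sub>\<mu>) \<M> (\<psi>[Y]\<^sub>\<mu>))"

end

theory Submission
  imports Defs
begin

text \<open>
  If \<open>w\<close> satisfies \<open>\<phi>\<close>, take for \<open>X\<close> the \<open>\<mu>\<close>-subformulas that hold infinitely often and for \<open>Y\<close> the
  \<open>\<nu>\<close>-subformulas that hold almost always.  Past some index \<open>i\<close> every \<open>\<mu>\<close>-subformula that ever holds
  is in \<open>X\<close> and every formula of \<open>Y\<close> always holds; from there on both substitutions preserve truth.
  Conversely, substitution by a set of formulas true infinitely often (resp. always) can only make a
  formula harder to satisfy.  Whether a \<open>\<mu>\<close>-formula \<open>\<psi>\<close> holds can thus be read off \<open>\<psi>[Y]\<^sub>\<mu>\<close>, which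
  depends only on the \<open>\<nu>\<close>-formulas of \<open>Y\<close> strictly below \<open>\<psi>\<close>, and dually.  So the conditions on \<open>X\<close>
  and \<open>Y\<close> are not circular, and an induction on size shows that the formulas of \<open>X\<close> do hold infinitely
  often and those of \<open>Y\<close> always.
\<close>

declare suffix_nth [simp del]

section \<open>Subformulas and their behaviour under \<open>af\<close>\<close>

lemma finite_subformulas: "finite (subformulas \<psi>)"
  by (induction \<psi>) simp_all

lemma subformulas_size: "\<chi> \<in> subformulas \<psi> \<Longrightarrow> \<chi> = \<psi> \<or> size \<chi> < size \<psi>"
  by (induction \<psi>) auto

lemma mu_subformulas_simps [simp]:
  "mu_subformulas TT = {}"
  "mu_subformulas FF = {}"
  "mu_subformulas (Prop a) = {}"
  "mu_subformulas (NProp a) = {}"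
  "mu_subformulas (\<phi> \<^bold>\<and> \<psi>) = mu_subformulas \<phi> \<union> mu_subformulas \<psi>"
  "mu_subformulas (\<phi> \<^bold>\<or> \<psi>) = mu_subformulas \<phi> \<union> mu_subformulas \<psi>"
  "mu_subformulas (\<X> \<phi>) = mu_subformulas \<phi>"
  "mu_subformulas (\<F> \<phi>) = insert (\<F> \<phi>) (mu_subformulas \<phi>)"
  "mu_subformulas (\<G> \<phi>) = mu_subformulas \<phi>"
  "mu_subformulas (\<phi> \<U> \<psi>) = insert (\<phi> \<U> \<psi>) (mu_subformulas \<phi> \<union> mu_subformulas \<psi>)"
  "mu_subformulas (\<phi> \<W> \<psi>) = mu_subformulas \<phi> \<union> mu_subformulas \<psi>"
  "mu_subformulas (\<phi> \<M> \<psi>) = insert (\<phi> \<M> \<psi>) (mu_subformulas \<phi> \<union> mu_subformulas \<psi>)"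
  "mu_subformulas (\<phi> \<R> \<psi>) = mu_subformulas \<phi> \<union> mu_subformulas \<psi>"
  unfolding mu_subformulas_def by auto

lemma nu_subformulas_simps [simp]:
  "nu_subformulas TT = {}"
  "nu_subformulas FF = {}"
  "nu_subformulas (Prop a) = {}"
  "nu_subformulas (NProp a) = {}"
  "nu_subformulas (\<phi> \<^bold>\<and> \<psi>) = nu_subformulas \<phi> \<union> nu_subformulas \<psi>"
  "nu_subformulas (\<phi> \<^bold>\<or> \<psi>) = nu_subformulas \<phi> \<union> nu_subformulas \<psi>"
  "nu_subformulas (\<X> \<phi>) = nu_subformulas \<phi>"
  "nu_subformulas (\<F> \<phi>) = nu_subformulas \<phi>"
  "nu_subformulas (\<G> \<phi>) = insert (\<G> \<phi>) (nu_subformulas \<phi>)"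
  "nu_subformulas (\<phi> \<U> \<psi>) = nu_subformulas \<phi> \<union> nu_subformulas \<psi>"
  "nu_subformulas (\<phi> \<W> \<psi>) = insert (\<phi> \<W> \<psi>) (nu_subformulas \<phi> \<union> nu_subformulas \<psi>)"
  "nu_subformulas (\<phi> \<M> \<psi>) = nu_subformulas \<phi> \<union> nu_subformulas \<psi>"
  "nu_subformulas (\<phi> \<R> \<psi>) = insert (\<phi> \<R> \<psi>) (nu_subformulas \<phi> \<union> nu_subformulas \<psi>)"
  unfolding nu_subformulas_def by auto

lemma subformulas_trans: "\<chi> \<in> subformulas \<psi> \<Longrightarrow> subformulas \<chi> \<subseteq> subformulas \<psi>"
  by (induction \<psi>) auto

lemma mu_subformulas_mono: "\<chi> \<in> subformulas \<psi> \<Longrightarrow> mu_subformulas \<chi> \<subseteq> mu_subformulas \<psi>"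
  using subformulas_trans unfolding mu_subformulas_def by blast

lemma nu_subformulas_mono: "\<chi> \<in> subformulas \<psi> \<Longrightarrow> nu_subformulas \<chi> \<subseteq> nu_subformulas \<psi>"
  using subformulas_trans unfolding nu_subformulas_def by blast

lemma mu_subformulas_af_letter: "mu_subformulas (af_letter \<phi> \<sigma>) \<subseteq> mu_subformulas \<phi>"
  by (induction \<phi>) auto

text \<open>Lets a set \<open>X\<close> chosen for \<open>\<phi>\<close> serve the substitution in
  \<open>af \<phi> u\<close>: each step only forms Boolean combinations of subformulas and
  constants.\<close>

lemma mu_subformulas_af: "mu_subformulas (af \<phi> u) \<subseteq> mu_subformulas \<phi>"
  using mu_subformulas_af_letter by (induction \<phi> u rule: af.induct) fastforce+

section \<open>Expansion laws and semantic correctness of \<open>af\<close>\<close>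

lemma ex_nat_unfold: "(\<exists>k::nat. P k) \<longleftrightarrow> P 0 \<or> (\<exists>k. P (Suc k))"
  by (metis not0_implies_Suc)

lemma all_nat_unfold: "(\<forall>k::nat. P k) \<longleftrightarrow> P 0 \<and> (\<forall>k. P (Suc k))"
  by (metis not0_implies_Suc)

text \<open>Splitting off position 0 of each quantifier gives laws of the same shape as the clauses
  of \<open>af_letter\<close>.\<close>

lemma models_unfold:
  "w \<Turnstile> \<F> \<phi> \<longleftrightarrow> w \<Turnstile> \<phi> \<or> suffix 1 w \<Turnstile> \<F> \<phi>"
  "w \<Turnstile> \<G> \<phi> \<longleftrightarrow> w \<Turnstile> \<phi> \<and> suffix 1 w \<Turnstile> \<G> \<phi>"
  "w \<Turnstile> \<phi> \<U> \<psi> \<longleftrightarrow> w \<Turnstile> \<psi> \<or> w \<Turnstile> \<phi> \<and> suffix 1 w \<Turnstile> \<phi> \<U> \<psi>"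
  "w \<Turnstile> \<phi> \<M> \<psi> \<longleftrightarrow> w \<Turnstile> \<psi> \<and> (w \<Turnstile> \<phi> \<or> suffix 1 w \<Turnstile> \<phi> \<M> \<psi>)"
proof -
  show "w \<Turnstile> \<F> \<phi> \<longleftrightarrow> w \<Turnstile> \<phi> \<or> suffix 1 w \<Turnstile> \<F> \<phi>"
    using ex_nat_unfold[of "\<lambda>k. suffix k w \<Turnstile> \<phi>"] by simp
  show "w \<Turnstile> \<G> \<phi> \<longleftrightarrow> w \<Turnstile> \<phi> \<and> suffix 1 w \<Turnstile> \<G> \<phi>"
    using all_nat_unfold[of "\<lambda>k. suffix k w \<Turnstile> \<phi>"] by simp
  show "w \<Turnstile> \<phi> \<U> \<psi> \<longleftrightarrow> w \<Turnstile> \<psi> \<or> w \<Turnstile> \<phi> \<and> suffix 1 w \<Turnstile> \<phi> \<U> \<psi>"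
    using ex_nat_unfold[of "\<lambda>k. suffix k w \<Turnstile> \<psi> \<and> (\<forall>j<k. suffix j w \<Turnstile> \<phi>)"]
    by (simp add: All_less_Suc2) blast
  have "(\<forall>j\<le>Suc k. suffix j w \<Turnstile> \<psi>) \<longleftrightarrow> w \<Turnstile> \<psi> \<and> (\<forall>j\<le>k. suffix (Suc j) w \<Turnstile> \<psi>)" for k
    using All_less_Suc2[of "Suc k" "\<lambda>j. suffix j w \<Turnstile> \<psi>"] by (simp add: less_Suc_eq_le)
  then show "w \<Turnstile> \<phi> \<M> \<psi> \<longleftrightarrow> w \<Turnstile> \<psi> \<and> (w \<Turnstile> \<phi> \<or> suffix 1 w \<Turnstile> \<phi> \<M> \<psi>)"
    using ex_nat_unfold[of "\<lambda>k. suffix k w \<Turnstile> \<phi> \<and> (\<forall>j\<le>k. suffix j w \<Turnstile> \<psi>)"]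
    by simp blast
qed

lemma models_unfold_weak:
  "w \<Turnstile> \<phi> \<W> \<psi> \<longleftrightarrow> w \<Turnstile> \<psi> \<or> w \<Turnstile> \<phi> \<and> suffix 1 w \<Turnstile> \<phi> \<W> \<psi>"
  "w \<Turnstile> \<phi> \<R> \<psi> \<longleftrightarrow> w \<Turnstile> \<psi> \<and> (w \<Turnstile> \<phi> \<or> suffix 1 w \<Turnstile> \<phi> \<R> \<psi>)"
  unfolding models_WeakUntil models_Release using models_unfold by blast+

lemma models_af_letter: "suffix 1 w \<Turnstile> af_letter \<phi> (w 0) \<longleftrightarrow> w \<Turnstile> \<phi>"
proof (induction \<phi>)
  case (Finally \<phi>)
  \<comment> \<open>The semantic clause is withheld from simp so that the formula on
    \<open>suffix 1 w\<close> stays folded and matches the copy left by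
    \<open>af_letter\<close>.\<close>
  then show ?case by (subst models_unfold) (simp del: models.simps(8))
next
  case (Globally \<phi>)
  then show ?case by (subst models_unfold) (simp del: models.simps(9))
next
  case (Until \<phi> \<psi>)
  then show ?case by (subst models_unfold) (simp del: models.simps(10))
next
  case (WeakUntil \<phi> \<psi>)
  then show ?case by (subst models_unfold_weak) (simp del: models.simps(11))
next
  case (StrongRelease \<phi> \<psi>)
  then show ?case by (subst models_unfold) (simp del: models.simps(12))
next
  case (Release \<phi> \<psi>)
  then show ?case by (subst models_unfold_weak) (simp del: models.simps(13))
qed simp_all

text \<open>\<open>af\<close> consumes letters from the front, so the induction generalizes over
  both the word and the formula.\<close>

lemma models_af: "suffix i w \<Turnstile> af \<phi> (w[0 \<rightarrow> i]) \<longleftrightarrow> w \<Turnstile> \<phi>"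
proof (induction i arbitrary: w \<phi>)
  case (Suc i)
  have "w[0 \<rightarrow> Suc i] = w 0 # (suffix 1 w[0 \<rightarrow> i])"
    unfolding subsequence_def suffix_def by (simp add: upt_conv_Cons map_Suc_upt[symmetric] del: upt_Suc)
  moreover have "suffix (Suc i) w = suffix i (suffix 1 w)"
    by simp
  ultimately show ?case
    by (simp only: af.simps Suc models_af_letter)
qed simp

section \<open>Effect of the two substitutions on truth\<close>

text \<open>A true \<mu>-subformula is never replaced by \<open>FF\<close>, since it lies in
  \<open>X\<close>; the other replacements, such as \<open>\<W>\<close> for \<open>\<U>\<close>,
  only weaken.\<close>

lemma models_subst_nuI:
  assumes "\<And>\<chi> k. \<chi> \<in> mu_subformulas \<psi> \<Longrightarrow> suffix k w \<Turnstile> \<chi> \<Longrightarrow> \<chi> \<in> X"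
    and "suffix n w \<Turnstile> \<psi>"
  shows "suffix n w \<Turnstile> \<psi>[X]\<^sub>\<nu>"
  using assms
proof (induction \<psi> arbitrary: n)
  case (Finally \<psi>)
  then show ?case by (simp del: models.simps(8))
next
  case (Until \<phi> \<psi>)
  have "\<phi> \<U> \<psi> \<in> X" using Until.prems by (simp del: models.simps(10))
  then show ?case using Until by simp blast
next
  case (StrongRelease \<phi> \<psi>)
  have "\<phi> \<M> \<psi> \<in> X" using StrongRelease.prems by (simp del: models.simps(12))
  then show ?case using StrongRelease by simp blast
next
  case (WeakUntil \<phi> \<psi>)
  then show ?case by simp blast
next
  case (Release \<phi> \<psi>)
  then show ?case by simp blast
qed auto

text \<open>The substitution forgets only eventualities. For members of \<open>X\<close> these
  return from \<open>\<F> \<chi>\<close>: if the weak operator holds through its \<open>\<G>\<close>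
  case, the recurrence of \<open>\<chi>\<close> supplies the missing endpoint.\<close>

lemma models_subst_nuD:
  assumes "\<And>\<chi> k. \<chi> \<in> mu_subformulas \<psi> \<Longrightarrow> \<chi> \<in> X \<Longrightarrow> suffix k w \<Turnstile> \<F> \<chi>"
    and "suffix n w \<Turnstile> \<psi>[X]\<^sub>\<nu>"
  shows "suffix n w \<Turnstile> \<psi>"
  using assms
proof (induction \<psi> arbitrary: n)
  case (Finally \<psi>)
  then have "suffix n w \<Turnstile> \<F> (\<F> \<psi>)"
    by (simp del: models.simps(8) split: if_splits)
  then show ?case by (auto simp: add.assoc)
next
  case (Until \<phi> \<psi>)
  then have "suffix n w \<Turnstile> \<F> (\<phi> \<U> \<psi>)" and W: "suffix n w \<Turnstile> \<phi>[X]\<^sub>\<nu> \<W> \<psi>[X]\<^sub>\<nu>"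
    by (simp_all del: models.simps split: if_splits) (auto split: if_splits)
  then have ev: "\<exists>k. suffix (n + k) w \<Turnstile> \<psi>" by (auto simp: add.assoc)
  have "suffix n w \<Turnstile> \<phi> \<W> \<psi>"
    using W Until.IH Until.prems(1) by simp blast
  moreover have "suffix n w \<Turnstile> \<phi> \<U> \<psi>" if "suffix n w \<Turnstile> \<G> \<phi>"
    using ev that by auto
  ultimately show ?case unfolding models_WeakUntil by blast
next
  case (StrongRelease \<phi> \<psi>)
  then have "suffix n w \<Turnstile> \<F> (\<phi> \<M> \<psi>)" and R: "suffix n w \<Turnstile> \<phi>[X]\<^sub>\<nu> \<R> \<psi>[X]\<^sub>\<nu>"
    by (simp_all del: models.simps split: if_splits) (auto split: if_splits)
  then have ev: "\<exists>k. suffix (n + k) w \<Turnstile> \<phi>" by (auto simp: add.assoc)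
  have "suffix n w \<Turnstile> \<phi> \<R> \<psi>"
    using R StrongRelease.IH StrongRelease.prems(1) by simp blast
  moreover have "suffix n w \<Turnstile> \<phi> \<M> \<psi>" if "suffix n w \<Turnstile> \<G> \<psi>"
    using ev that by auto
  ultimately show ?case unfolding models_Release by blast
next
  case (WeakUntil \<phi> \<psi>)
  then show ?case by simp blast
next
  case (Release \<phi> \<psi>)
  then show ?case by simp blast
qed auto

text \<open>The strong replacement could fail only where a \<nu>-formula holds through its
  \<open>\<G>\<close> case. There it holds at all later positions too, so it lies in
  \<open>Y\<close> and becomes \<open>TT\<close>.\<close>

lemma models_subst_muI:
  assumes "\<And>\<chi> k. \<chi> \<in> nu_subformulas \<psi> \<Longrightarrow> suffix k w \<Turnstile> \<G> \<chi> \<Longrightarrow> \<chi> \<in> Y"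
    and "suffix n w \<Turnstile> \<psi>"
  shows "suffix n w \<Turnstile> \<psi>[Y]\<^sub>\<mu>"
  using assms
proof (induction \<psi> arbitrary: n)
  case (Globally \<psi>)
  from Globally.prems(2) have "suffix n w \<Turnstile> \<G> (\<G> \<psi>)" by (simp add: add.assoc)
  then have "\<G> \<psi> \<in> Y" using Globally.prems(1) by (simp del: models.simps)
  then show ?case by simp
next
  case (WeakUntil \<phi> \<psi>)
  have "suffix n w \<Turnstile> \<G> (\<phi> \<W> \<psi>)" if "suffix n w \<Turnstile> \<G> \<phi>"
    using that by (simp add: add.assoc)
  then have "\<phi> \<W> \<psi> \<in> Y" if "suffix n w \<Turnstile> \<G> \<phi>"
    using that WeakUntil.prems(1)[of "\<phi> \<W> \<psi>" n] by (simp del: models.simps)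
  moreover have "suffix n w \<Turnstile> \<phi>[Y]\<^sub>\<mu> \<U> \<psi>[Y]\<^sub>\<mu>" if "suffix n w \<Turnstile> \<phi> \<U> \<psi>"
    using that WeakUntil.IH WeakUntil.prems(1) by simp blast
  ultimately show ?case
    using WeakUntil.prems(2) unfolding models_WeakUntil by (auto simp del: models.simps(9-13))
next
  case (Release \<phi> \<psi>)
  have "suffix n w \<Turnstile> \<G> (\<phi> \<R> \<psi>)" if "suffix n w \<Turnstile> \<G> \<psi>"
    using that by (simp add: add.assoc)
  then have "\<phi> \<R> \<psi> \<in> Y" if "suffix n w \<Turnstile> \<G> \<psi>"
    using that Release.prems(1)[of "\<phi> \<R> \<psi>" n] by (simp del: models.simps)
  moreover have "suffix n w \<Turnstile> \<phi>[Y]\<^sub>\<mu> \<M> \<psi>[Y]\<^sub>\<mu>" if "suffix n w \<Turnstile> \<phi> \<M> \<psi>"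
    using that Release.IH Release.prems(1) by simp blast
  ultimately show ?case
    using Release.prems(2) unfolding models_Release by (auto simp del: models.simps(9-13))
next
  case (Until \<phi> \<psi>)
  then show ?case by simp blast
next
  case (StrongRelease \<phi> \<psi>)
  then show ?case by simp blast
qed auto

text \<open>Replacing a member of \<open>Y\<close> by \<open>TT\<close> is harmless because it holds
  everywhere; outside \<open>Y\<close> the replacement is stronger than the original.\<close>

lemma models_subst_muD:
  assumes "\<And>\<chi> k. \<chi> \<in> nu_subformulas \<psi> \<Longrightarrow> \<chi> \<in> Y \<Longrightarrow> suffix k w \<Turnstile> \<chi>"
    and "suffix n w \<Turnstile> \<psi>[Y]\<^sub>\<mu>"
  shows "suffix n w \<Turnstile> \<psi>"
  using assms
proof (induction \<psi> arbitrary: n)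
  case (Globally \<psi>)
  then show ?case by (simp del: models.simps(9) split: if_splits)
next
  case (WeakUntil \<phi> \<psi>)
  show ?case
  proof (cases "\<phi> \<W> \<psi> \<in> Y")
    case True
    then show ?thesis using WeakUntil.prems(1) by (simp del: models.simps)
  next
    case False
    then show ?thesis using WeakUntil by simp blast
  qed
next
  case (Release \<phi> \<psi>)
  show ?case
  proof (cases "\<phi> \<R> \<psi> \<in> Y")
    case True
    then show ?thesis using Release.prems(1) by (simp del: models.simps)
  next
    case False
    then show ?thesis using Release by simp blast
  qed
next
  case (Until \<phi> \<psi>)
  then show ?case by simp blast
next
  case (StrongRelease \<phi> \<psi>)
  then show ?case by simp blast
qed auto

section \<open>Correctness of guessed sets\<close>

text \<open>Ensures that a member of \<open>Y\<close> inside a member of \<open>X\<close>, or vice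
  versa, is a proper subformula and hence smaller.\<close>

lemma mu_subformulas_disjoint_nu_subformulas: "mu_subformulas \<phi> \<inter> nu_subformulas \<psi> = {}"
  unfolding mu_subformulas_def nu_subformulas_def by auto

text \<open>Both claims share one induction because each uses the other at smaller sizes. They have
  the form that \<open>models_subst_nuD\<close> and \<open>models_subst_muD\<close> require.\<close>

lemma models_of_guesses:
  assumes X: "X \<subseteq> mu_subformulas \<phi>" and Y: "Y \<subseteq> nu_subformulas \<phi>"
    and GF: "\<And>\<psi>. \<psi> \<in> X \<Longrightarrow> w \<Turnstile> \<G> (\<F> (\<psi>[Y]\<^sub>\<mu>))"
    and G: "\<And>\<psi>. \<psi> \<in> Y \<Longrightarrow> w \<Turnstile> \<G> (\<psi>[X]\<^sub>\<nu>)"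
  shows "(\<psi> \<in> X \<longrightarrow> (\<forall>k. suffix k w \<Turnstile> \<F> \<psi>)) \<and> (\<psi> \<in> Y \<longrightarrow> (\<forall>k. suffix k w \<Turnstile> \<psi>))"
proof (induction \<psi> rule: measure_induct_rule[of size])
  case (less \<psi>)
  have "suffix k w \<Turnstile> \<F> \<psi>" if "\<psi> \<in> X" for k
  proof -
    have below: "suffix m w \<Turnstile> \<chi>" if "\<chi> \<in> nu_subformulas \<psi>" "\<chi> \<in> Y" for \<chi> m
    proof -
      have "\<chi> \<noteq> \<psi>"
        using X Y \<open>\<psi> \<in> X\<close> \<open>\<chi> \<in> Y\<close> mu_subformulas_disjoint_nu_subformulas by blast
      then have "size \<chi> < size \<psi>"
        using \<open>\<chi> \<in> nu_subformulas \<psi>\<close> subformulas_size unfolding nu_subformulas_def by blast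
      then show ?thesis using less \<open>\<chi> \<in> Y\<close> by blast
    qed
    from GF[OF that] obtain j where "suffix (k + j) w \<Turnstile> \<psi>[Y]\<^sub>\<mu>"
      by auto
    then have "suffix (k + j) w \<Turnstile> \<psi>" using below models_subst_muD by blast
    then show ?thesis by auto
  qed
  moreover have "suffix k w \<Turnstile> \<psi>" if "\<psi> \<in> Y" for k
  proof -
    have below: "suffix m w \<Turnstile> \<F> \<chi>" if "\<chi> \<in> mu_subformulas \<psi>" "\<chi> \<in> X" for \<chi> m
    proof -
      have "\<chi> \<noteq> \<psi>"
        using X Y \<open>\<psi> \<in> Y\<close> \<open>\<chi> \<in> X\<close> mu_subformulas_disjoint_nu_subformulas by blast
      then have "size \<chi> < size \<psi>"
        using \<open>\<chi> \<in> mu_subformulas \<psi>\<close> subformulas_size unfolding mu_subformulas_def by blast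
      then show ?thesis using less \<open>\<chi> \<in> X\<close> by blast
    qed
    have "suffix k w \<Turnstile> \<psi>[X]\<^sub>\<nu>" using G[OF that] by simp
    then show ?thesis using below models_subst_nuD by blast
  qed
  ultimately show ?case by blast
qed

section \<open>Stabilization along a word\<close>

text \<open>Each formula settles from some index on; finiteness of \<open>S\<close> lets one index
  serve all of them.\<close>

lemma ex_stabilization_index:
  fixes S :: "'a ltl set"
  assumes "finite S"
  shows "\<exists>i. \<forall>\<psi>\<in>S.
    ((\<exists>k\<ge>i. suffix k w \<Turnstile> \<psi>) \<longrightarrow> w \<Turnstile> \<G> (\<F> \<psi>)) \<and> (w \<Turnstile> \<F> (\<G> \<psi>) \<longrightarrow> (\<forall>k\<ge>i. suffix k w \<Turnstile> \<psi>))"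
proof -
  \<comment> \<open>Phrased pointwise in \<open>k\<close>, both properties are eventual, so the
    filter rules for conjunctions and finite sets replace explicit maxima.\<close>
  have "\<forall>\<^sub>F k in sequentially. (suffix k w \<Turnstile> \<psi> \<longrightarrow> w \<Turnstile> \<G> (\<F> \<psi>)) \<and> (w \<Turnstile> \<F> (\<G> \<psi>) \<longrightarrow> suffix k w \<Turnstile> \<psi>)"
    for \<psi>
  proof (rule eventually_conj)
    show "\<forall>\<^sub>F k in sequentially. suffix k w \<Turnstile> \<psi> \<longrightarrow> w \<Turnstile> \<G> (\<F> \<psi>)"
    proof (cases "w \<Turnstile> \<G> (\<F> \<psi>)")
      case False
      then obtain n where n: "\<And>j. \<not> suffix (n + j) w \<Turnstile> \<psi>" by auto
      have "\<not> suffix k w \<Turnstile> \<psi>" if "k \<ge> n" for k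
        using n[of "k - n"] that by simp
      then show ?thesis unfolding eventually_sequentially by blast
    qed simp
    show "\<forall>\<^sub>F k in sequentially. w \<Turnstile> \<F> (\<G> \<psi>) \<longrightarrow> suffix k w \<Turnstile> \<psi>"
    proof (cases "w \<Turnstile> \<F> (\<G> \<psi>)")
      case True
      then obtain n where n: "\<And>j. suffix (n + j) w \<Turnstile> \<psi>" by auto
      have "suffix k w \<Turnstile> \<psi>" if "k \<ge> n" for k
        using n[of "k - n"] that by simp
      then show ?thesis unfolding eventually_sequentially by blast
    qed (simp del: models.simps)
  qed
  then have "\<forall>\<^sub>F k in sequentially. \<forall>\<psi>\<in>S.
      (suffix k w \<Turnstile> \<psi> \<longrightarrow> w \<Turnstile> \<G> (\<F> \<psi>)) \<and> (w \<Turnstile> \<F> (\<G> \<psi>) \<longrightarrow> suffix k w \<Turnstile> \<psi>)"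
    using assms by (simp add: eventually_ball_finite del: models.simps)
  then show ?thesis unfolding eventually_sequentially by blast
qed

theorem theorem8p1:
  fixes Ap :: "'a set" and \<phi> :: "'a ltl" and w :: "'a set word"
  assumes "finite Ap" and "atoms \<phi> \<subseteq> Ap" and "range w \<subseteq> Pow Ap"
  shows "w \<Turnstile> \<phi> \<longleftrightarrow>
    (\<exists>X \<subseteq> mu_subformulas \<phi>. \<exists>Y \<subseteq> nu_subformulas \<phi>. \<exists>i.
      suffix i w \<Turnstile> (af \<phi> (w[0 \<rightarrow> i]))[X]\<^sub>\<nu> \<and>
      (\<forall>\<psi>\<in>X. suffix i w \<Turnstile> \<G> (\<F> (\<psi>[Y]\<^sub>\<mu>))) \<and>
      (\<forall>\<psi>\<in>Y. suffix i w \<Turnstile> \<G> (\<psi>[X]\<^sub>\<nu>)))"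
    (is "_ \<longleftrightarrow> ?guess")
proof
  assume "w \<Turnstile> \<phi>"
  \<comment> \<open>Both sets refer to the whole word, hence do not depend on \<open>i\<close>,
    which is chosen afterwards.\<close>
  define X where "X = {\<psi> \<in> mu_subformulas \<phi>. w \<Turnstile> \<G> (\<F> \<psi>)}"
  define Y where "Y = {\<psi> \<in> nu_subformulas \<phi>. w \<Turnstile> \<F> (\<G> \<psi>)}"
  from ex_stabilization_index[OF finite_subformulas, of \<phi> w] obtain i where
    stable_GF: "\<And>\<psi> k. \<psi> \<in> subformulas \<phi> \<Longrightarrow> k \<ge> i \<Longrightarrow> suffix k w \<Turnstile> \<psi> \<Longrightarrow> w \<Turnstile> \<G> (\<F> \<psi>)" and
    stable_FG: "\<And>\<psi> k. \<psi> \<in> subformulas \<phi> \<Longrightarrow> w \<Turnstile> \<F> (\<G> \<psi>) \<Longrightarrow> k \<ge> i \<Longrightarrow> suffix k w \<Turnstile> \<psi>"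
    by blast
  have in_X: "\<chi> \<in> X" if "\<chi> \<in> mu_subformulas \<phi>" "suffix k (suffix i w) \<Turnstile> \<chi>" for \<chi> k
    using that stable_GF[of \<chi> "i + k"] unfolding X_def mu_subformulas_def
    by (simp del: models.simps)
  \<comment> \<open>Here, in contrast to \<open>in_X\<close>, \<open>k\<close> ranges over all
    positions of \<open>w\<close>: \<open>\<G> \<chi>\<close> at any of them gives
    \<open>\<F> (\<G> \<chi>)\<close> on \<open>w\<close>.\<close>
  have in_Y: "\<chi> \<in> Y" if "\<chi> \<in> nu_subformulas \<phi>" "suffix k w \<Turnstile> \<G> \<chi>" for \<chi> k
    using that unfolding Y_def by auto
  have "suffix i w \<Turnstile> af \<phi> (w[0 \<rightarrow> i])"
    using \<open>w \<Turnstile> \<phi>\<close> by (simp only: models_af)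
  then have "suffix i w \<Turnstile> (af \<phi> (w[0 \<rightarrow> i]))[X]\<^sub>\<nu>"
    \<comment> \<open>The base word is \<open>suffix i w\<close> at position 0, so membership in
      \<open>X\<close> is demanded only of formulas true past \<open>i\<close>.\<close>
    using models_subst_nuI[of _ "suffix i w" X 0] in_X mu_subformulas_af
    by (metis subsetD suffix_0)
  moreover have "suffix i w \<Turnstile> \<G> (\<F> (\<psi>[Y]\<^sub>\<mu>))" if "\<psi> \<in> X" for \<psi>
  proof -
    have "\<psi> \<in> subformulas \<phi>" using that unfolding X_def mu_subformulas_def by blast
    then have "suffix n w \<Turnstile> \<psi>[Y]\<^sub>\<mu>" if "suffix n w \<Turnstile> \<psi>" for n
      using models_subst_muI[of \<psi> w Y n] that in_Y nu_subformulas_mono by blast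
    moreover have "\<exists>j. suffix (i + k + j) w \<Turnstile> \<psi>" for k
      using that unfolding X_def by simp
    ultimately show ?thesis by (simp add: add.assoc) blast
  qed
  moreover have "suffix i w \<Turnstile> \<G> (\<psi>[X]\<^sub>\<nu>)" if "\<psi> \<in> Y" for \<psi>
  proof -
    have sub: "\<psi> \<in> subformulas \<phi>" and "w \<Turnstile> \<F> (\<G> \<psi>)"
      using that unfolding Y_def nu_subformulas_def by blast+
    then have "suffix k (suffix i w) \<Turnstile> \<psi>" for k
      using stable_FG[of \<psi> "i + k"] by (simp del: models.simps)
    then have "suffix k (suffix i w) \<Turnstile> \<psi>[X]\<^sub>\<nu>" for k
      using models_subst_nuI[of \<psi> "suffix i w" X k] in_X mu_subformulas_mono[OF sub] by blast
    then show ?thesis by simp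
  qed
  moreover have "X \<subseteq> mu_subformulas \<phi>" "Y \<subseteq> nu_subformulas \<phi>"
    unfolding X_def Y_def by blast+
  ultimately show ?guess by blast
next
  assume ?guess
  then obtain X Y i where "X \<subseteq> mu_subformulas \<phi>" "Y \<subseteq> nu_subformulas \<phi>"
    and af: "suffix i w \<Turnstile> (af \<phi> (w[0 \<rightarrow> i]))[X]\<^sub>\<nu>"
    and "\<And>\<psi>. \<psi> \<in> X \<Longrightarrow> suffix i w \<Turnstile> \<G> (\<F> (\<psi>[Y]\<^sub>\<mu>))"
    and "\<And>\<psi>. \<psi> \<in> Y \<Longrightarrow> suffix i w \<Turnstile> \<G> (\<psi>[X]\<^sub>\<nu>)"
    by blast
  \<comment> \<open>Recurrence is obtained for all of \<open>X\<close>, hence for whichever members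
    occur in the unfolded formula.\<close>
  then have "suffix k (suffix i w) \<Turnstile> \<F> \<chi>" if "\<chi> \<in> X" for \<chi> k
    using models_of_guesses[of X \<phi> Y "suffix i w" \<chi>] that by blast
  then have "suffix i w \<Turnstile> af \<phi> (w[0 \<rightarrow> i])"
    using models_subst_nuD[of _ X "suffix i w" 0] af by (metis suffix_0)
  then show "w \<Turnstile> \<phi>" by (simp only: models_af)
qed

end
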